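(* Let $\gamma>2$, $\beta>0$, $X=\{-1,1\}^{\mathbb N}$ with points $x=(x_1,x_2,\dots)$, and let $A(x)=\sum_{j=1}^{\infty}j^{-\gamma}x_1x_{j+1}$. Let $\lambda_{\beta A}$ be the spectral radius (main eigenvalue) of the Ruelle operator $\mathscr L_{\beta A}$ on $C(X)$ and let $P(\beta A)=\log\lambda_{\beta A}$ be the pressure. Then $$P(\beta A)=\log\lambda_{\beta A}<\log\big(2\cosh(\beta\,\zeta(\gamma))\big),$$ where $\zeta$ is the Riemann zeta function.
   Context: The Ruelle operator of a continuous potential $B:X\to\mathbb R$ is $\mathscr L_B:C(X)\to C(X)$, $\mathscr L_B(f)(x)=\sum_{i\in\{-1,1\}}e^{B(i,x_1,x_2,\dots)}f(i,x_1,x_2,\dots)$, where $C(X)$ carries the supremum norm. *)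

theory Defs
  imports "HOL-Analysis.Analysis"
begin

typedef spin = "{-1, 1::real}" morphisms spin_val Abs_spin
  by auto

setup_lifting type_definition_spin

lift_definition spin_up :: spin is "1" by simp
lift_definition spin_down :: spin is "-1" by simp

lemma UNIV_spin: "(UNIV :: spin set) = {spin_down, spin_up}"
  by (auto, transfer, auto)

lemma spin_down_neq_up [simp]: "spin_down \<noteq> spin_up"
  by transfer simp

instance spin :: finite
  by standard (simp add: UNIV_spin)

instantiation spin :: discrete_topology
begin

definition open_spin :: "spin set \<Rightarrow> bool"
  where "open_spin S \<longleftrightarrow> True"

instance
  by standard (auto simp: open_spin_def)

end

text \<open>
  The space of configurations carries the product topology of HOL-Analysis on
  function types. Sites are indexed from \<open>0\<close>: the coordinate \<open>x\<^sub>j\<close> with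
  \<open>j \<ge> 1\<close> of the mathematical text is \<open>x (j - 1)\<close>. Prepending \<open>i\<close> to \<open>x\<close>
  is \<open>case_nat i x\<close>.
\<close>

type_synonym config = "nat \<Rightarrow> spin"

text \<open>As it is compact, all continuous functions on it are bounded, so that
  \<open>config \<Rightarrow>\<^sub>C 'b\<close> is the space of all continuous functions with the supremum norm.\<close>

lemma compact_UNIV_config: "compact (UNIV :: config set)"
proof -
  have "compact_space (product_topology (\<lambda>_::nat. (euclidean :: spin topology)) UNIV)"
    by (subst compact_space_product_topology)
      (simp add: compact_space_def compactin_euclidean_iff finite_imp_compact)
  then show ?thesis
    by (simp add: euclidean_product_topology compact_space_def compactin_euclidean_iff)
qed

lemma continuous_in_bcontfun:
  fixes f :: "config \<Rightarrow> 'b::metric_space"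
  assumes "continuous_on UNIV f"
  shows "f \<in> bcontfun"
  using assms compact_continuous_image[OF assms compact_UNIV_config]
  by (simp add: bcontfun_def compact_imp_bounded)

lemma continuous_on_case_nat: "continuous_on UNIV (case_nat i :: config \<Rightarrow> config)"
proof (rule continuous_on_coordinatewise_then_product)
  fix n :: nat
  show "continuous_on UNIV (\<lambda>x :: config. (case n of 0 \<Rightarrow> i | Suc m \<Rightarrow> x m))"
    by (cases n) auto
qed

text \<open>
  The Ruelle operator of a continuous real potential. It acts here on complex-valued
  functions, that is, it is the complexification of the operator on real-valued functions:
  the spectrum of an operator on a real Banach space is that of its complexification.
\<close>

definition ruelle_operator ::
    "(config \<Rightarrow> real) \<Rightarrow> (config \<Rightarrow>\<^sub>C complex) \<Rightarrow> (config \<Rightarrow>\<^sub>C complex)"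
  where "ruelle_operator B f =
    Bcontfun (\<lambda>x. \<Sum>i\<in>UNIV. exp (B (case_nat i x)) *\<^sub>R apply_bcontfun f (case_nat i x))"

lemma apply_ruelle_operator:
  assumes "continuous_on UNIV B"
  shows "apply_bcontfun (ruelle_operator B f) x =
    (\<Sum>i\<in>UNIV. exp (B (case_nat i x)) *\<^sub>R apply_bcontfun f (case_nat i x))"
proof -
  have "continuous_on UNIV
      (\<lambda>x. \<Sum>i\<in>UNIV. exp (B (case_nat i x)) *\<^sub>R apply_bcontfun f (case_nat i x))"
    by (intro continuous_intros continuous_on_compose2[OF assms]
        continuous_on_compose2[OF continuous_on_apply_bcontfun] continuous_on_case_nat) auto
  then show ?thesis
    unfolding ruelle_operator_def
    by (subst Bcontfun_inverse) (auto intro: continuous_in_bcontfun)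
qed

definition scaleC_bcontfun ::
    "complex \<Rightarrow> ('a::topological_space \<Rightarrow>\<^sub>C complex) \<Rightarrow> ('a \<Rightarrow>\<^sub>C complex)"
  where "scaleC_bcontfun z f = Bcontfun (\<lambda>x. z * apply_bcontfun f x)"

lemma apply_scaleC_bcontfun [simp]:
  "apply_bcontfun (scaleC_bcontfun z f) x = z * apply_bcontfun f x"
proof -
  have "bounded (range (\<lambda>x. z * apply_bcontfun f x))"
    using bounded_linear_image[OF bounded_apply_bcontfun[of f] bounded_linear_mult_right[of z]]
    by (simp add: image_image)
  then have "(\<lambda>x. z * apply_bcontfun f x) \<in> bcontfun"
    by (auto simp: bcontfun_def intro!: continuous_intros)
  then show ?thesis
    by (simp add: scaleC_bcontfun_def Bcontfun_inverse)
qed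

text \<open>
  \<open>bounded_linear\<close> is real-linear, but if \<open>T\<close> is complex-linear then so is every
  two-sided inverse of \<open>z - T\<close>; hence this is the usual complex spectrum.
\<close>

definition spectrum_op ::
    "(('a::topological_space \<Rightarrow>\<^sub>C complex) \<Rightarrow> ('a \<Rightarrow>\<^sub>C complex)) \<Rightarrow> complex set"
  where "spectrum_op T = {z. \<not> (\<exists>R. bounded_linear R \<and>
    (\<forall>f. R (scaleC_bcontfun z f - T f) = f) \<and>
    (\<forall>f. scaleC_bcontfun z (R f) - T (R f) = f))}"

definition spectral_radius_op ::
    "(('a::topological_space \<Rightarrow>\<^sub>C complex) \<Rightarrow> ('a \<Rightarrow>\<^sub>C complex)) \<Rightarrow> real"
  where "spectral_radius_op T = (SUP z\<in>spectrum_op T. cmod z)"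

definition pressure :: "(config \<Rightarrow> real) \<Rightarrow> real"
  where "pressure B = ln (spectral_radius_op (ruelle_operator B))"

text \<open>The sum over \<open>j \<ge> 1\<close> of \<open>j powr - \<gamma> * x\<^sub>1 * x\<^sub>j\<^sub>+\<^sub>1\<close>, with \<open>j\<close> written as \<open>Suc k\<close>.\<close>

definition dyson_potential :: "real \<Rightarrow> config \<Rightarrow> real"
  where "dyson_potential \<gamma> x =
    (\<Sum>k. real (Suc k) powr (- \<gamma>) * spin_val (x 0) * spin_val (x (Suc k)))"

lemma abs_spin_val [simp]: "\<bar>spin_val s\<bar> = 1"
  using spin_val[of s] by auto

lemma summable_powr_Suc:
  assumes "\<gamma> > (1::real)"
  shows "summable (\<lambda>k. real (Suc k) powr (- \<gamma>))"
  using assms summable_real_powr_iff[of "- \<gamma>"]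
  by (subst summable_Suc_iff) simp

lemma continuous_on_dyson_potential:
  assumes "\<gamma> > 1"
  shows "continuous_on UNIV (dyson_potential \<gamma>)"
proof -
  let ?f = "\<lambda>k (x :: config). real (Suc k) powr (- \<gamma>) * spin_val (x 0) * spin_val (x (Suc k))"
  have spin: "continuous_on UNIV (\<lambda>x :: config. spin_val (x n))" for n
  proof (rule continuous_on_compose2[of UNIV spin_val])
    show "continuous_on UNIV spin_val"
      by (simp add: continuous_on_open_vimage open_discrete)
  qed auto
  have "uniform_limit UNIV (\<lambda>n x. \<Sum>i<n. ?f i x) (\<lambda>x. \<Sum>i. ?f i x) sequentially"
    by (rule Weierstrass_m_test[OF _ summable_powr_Suc[OF assms]]) (simp add: abs_mult)
  then have "continuous_on UNIV (\<lambda>x. \<Sum>i. ?f i x)"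
    by (rule uniform_limit_theorem[rotated])
      (auto intro!: continuous_intros spin always_eventually)
  then show ?thesis
    by (simp add: dyson_potential_def[abs_def])
qed

text \<open>The Riemann zeta function at a real argument \<open>s > 1\<close>, where its series converges.\<close>

definition zeta_real :: "real \<Rightarrow> real"
  where "zeta_real s = (\<Sum>k. 1 / real (Suc k) powr s)"

end

theory Submission
  imports Defs
begin

text \<open>
  Since \<open>A(i,x) = i \<cdot> S(x)\<close> with \<open>S(x) = \<Sum>\<^sub>j j\<^sup>-\<^sup>\<gamma> x\<^sub>j\<close>, the function \<open>L 1 = 2 cosh (\<beta> S)\<close> is
  at most \<open>2 cosh (\<beta> \<zeta>(\<gamma>))\<close>, with equality only at the two constant configurations. For every
  \<open>x\<close> one of the two preimages \<open>(i,x)\<close>, the one with \<open>i \<noteq> x\<^sub>1\<close>, is uniformly far from these, so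
  the norm of \<open>L\<^sup>2\<close> is strictly smaller than \<open>(2 cosh (\<beta> \<zeta>(\<gamma>)))\<^sup>2\<close>, and a Neumann series
  bounds the spectrum. The spectrum is nonempty because \<open>L\<close> has a kernel.
\<close>

section \<open>Neumann series in a complete normed space\<close>

text \<open>
  The library makes \<open>'a \<Rightarrow>\<^sub>C 'b\<close> a Banach space only for a metric domain, and \<open>config\<close> is not in
  that class; so completeness appears below as a hypothesis instead of the class \<open>banach\<close>.
\<close>

lemma complete_UNIV_bcontfun:
  "complete (UNIV :: ('a::topological_space \<Rightarrow>\<^sub>C 'b::complete_space) set)"
proof (rule completeI)
  fix f :: "nat \<Rightarrow> 'a \<Rightarrow>\<^sub>C 'b"
  assume "Cauchy f"
  then have "uniformly_Cauchy_on UNIV (\<lambda>n. apply_bcontfun (f n))"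
    unfolding Cauchy_def uniformly_Cauchy_on_def by (meson dist_fun_lt_imp_dist_val_lt)
  then obtain g where "uniform_limit UNIV f g sequentially"
    using Cauchy_uniformly_convergent uniformly_convergent_on_def by blast
  from uniform_limit_bcontfunE[OF this sequentially_bot]
  show "\<exists>l\<in>UNIV. f \<longlonglongrightarrow> l" by (metis UNIV_I)
qed

text \<open>Increments of the partial sums of \<open>f\<close> are dominated by those of
  \<open>g\<close>, so the Cauchy property passes from \<open>g\<close> to \<open>f\<close>.\<close>

lemma complete_summable_norm:
  fixes f :: "nat \<Rightarrow> 'a::real_normed_vector"
  assumes complete: "complete (UNIV :: 'a set)" and le: "\<And>n. norm (f n) \<le> g n" and g: "summable g"
  shows "summable f" and "norm (suminf f) \<le> suminf g"
proof -
  have dist_le: "norm (sum f {..<n} - sum f {..<m}) \<le> norm (sum g {..<n} - sum g {..<m})"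
    if "m \<le> n" for m n
  proof -
    have "sum f {..<n} - sum f {..<m} = sum f {m..<n}" "sum g {..<n} - sum g {..<m} = sum g {m..<n}"
      using that by (simp_all add: sum_diff_nat_ivl lessThan_atLeast0)
    then show ?thesis
      using sum_norm_le[of "{m..<n}" f g] le by simp
  qed
  then have dist_le: "dist (sum f {..<m}) (sum f {..<n}) \<le> dist (sum g {..<m}) (sum g {..<n})" for m n
    by (cases "m \<le> n") (metis dist_commute dist_norm nat_le_linear)+
  have "Cauchy (\<lambda>n. sum g {..<n})"
    using g by (simp add: summable_iff_convergent convergent_Cauchy)
  then have "Cauchy (\<lambda>n. sum f {..<n})"
    unfolding Cauchy_def using dist_le by (meson le_less_trans)
  then show f: "summable f"
    using complete by (auto simp: complete_def summable_iff_convergent convergent_def)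
  show "norm (suminf f) \<le> suminf g"
  proof (rule tendsto_le[OF sequentially_bot summable_LIMSEQ[OF g] tendsto_norm[OF summable_LIMSEQ[OF f]]])
    show "\<forall>\<^sub>F n in sequentially. norm (sum f {..<n}) \<le> sum g {..<n}"
      by (intro always_eventually allI sum_norm_le le)
  qed
qed

text \<open>The inverse is the series of the powers of \<open>T\<close>, dominated termwise by a
  geometric series; its sum \<open>1 / (1 - q)\<close> bounds the norm of \<open>R\<close>.\<close>

lemma Neumann_inverse:
  fixes T :: "'a::real_normed_vector \<Rightarrow> 'a"
  assumes complete: "complete (UNIV :: 'a set)" and T: "bounded_linear T" and q: "0 \<le> q" "q < 1"
    and bound: "\<And>f. norm (T f) \<le> q * norm f"
  shows "\<exists>R. bounded_linear R \<and> (\<forall>f. R (f - T f) = f) \<and> (\<forall>f. R f - T (R f) = f)"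
proof -
  interpret T: bounded_linear T by (rule T)
  have npow: "norm ((T ^^ n) f) \<le> q ^ n * norm f" for n f
  proof (induction n)
    case (Suc n)
    have "norm (T ((T ^^ n) f)) \<le> q * norm ((T ^^ n) f)" by (rule bound)
    also have "\<dots> \<le> q * (q ^ n * norm f)" using Suc q by (intro mult_left_mono)
    finally show ?case by simp
  qed simp
  have linpow: "linear (T ^^ n)" for n
    by (induction n) (simp_all only: funpow.simps linear_id linear_compose T.linear)
  have sg: "summable (\<lambda>n. q ^ n * norm f)" for f
    using q by (intro summable_mult2 summable_geometric) auto
  have summ: "summable (\<lambda>n. (T ^^ n) f)" for f
    by (rule complete_summable_norm(1)[OF complete npow sg])
  define R where "R f = (\<Sum>n. (T ^^ n) f)" for f
  have blR: "bounded_linear R"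
  proof (rule bounded_linear_intro[where K = "1 / (1 - q)"])
    show "R (f + g) = R f + R g" for f g
      unfolding R_def by (simp add: linear_add[OF linpow] suminf_add summ)
    show "R (c *\<^sub>R f) = c *\<^sub>R R f" for c f
      unfolding R_def by (simp add: linear_scale[OF linpow] suminf_scaleR_right summ)
    show "norm (R f) \<le> norm f * (1 / (1 - q))" for f
    proof -
      have "norm (R f) \<le> (\<Sum>n. q ^ n * norm f)"
        unfolding R_def by (rule complete_summable_norm(2)[OF complete npow sg])
      also have "\<dots> = norm f * (1 / (1 - q))"
        using q by (subst suminf_mult2[symmetric]) (auto simp: suminf_geometric summable_geometric)
      finally show ?thesis .
    qed
  qed
  \<comment> \<open>\<open>T\<close> commutes with its own powers, hence with the series, so the
    left inverse identity follows from the right one.\<close>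
  have TR: "T (R f) = R (T f)" for f
    unfolding R_def T.suminf[OF summ] by (simp add: funpow_swap1)
  have right: "R f - T (R f) = f" for f
  proof -
    have "T (R f) = (\<Sum>n. (T ^^ Suc n) f)"
      unfolding R_def T.suminf[OF summ] by simp
    also have "\<dots> = R f - f"
      unfolding R_def using suminf_split_head[OF summ[of f]] by simp
    finally show ?thesis by simp
  qed
  moreover have "R (f - T f) = f" for f
    using right[of f] by (simp add: linear_diff[OF bounded_linear.linear[OF blR]] TR)
  ultimately show ?thesis using blR by blast
qed

text \<open>From 1 - T^2 = (1 - T)(1 + T), the inverse of 1 - T is (1 - T^2)^(-1) (1 + T). This
  suits the Ruelle operator, whose contraction estimate appears only after two steps.\<close>

lemma Neumann_inverse_square:
  fixes T :: "'a::real_normed_vector \<Rightarrow> 'a"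
  assumes complete: "complete (UNIV :: 'a set)" and T: "bounded_linear T" and q: "0 \<le> q" "q < 1"
    and bound: "\<And>f. norm (T (T f)) \<le> q * norm f"
  shows "\<exists>R. bounded_linear R \<and> (\<forall>f. R (f - T f) = f) \<and> (\<forall>f. R f - T (R f) = f)"
proof -
  interpret T: bounded_linear T by (rule T)
  obtain S where S: "bounded_linear S" "\<And>f. S (f - T (T f)) = f" "\<And>f. S f - T (T (S f)) = f"
    using Neumann_inverse[OF complete bounded_linear_compose[OF T T] q bound] by blast
  interpret S: bounded_linear S by (rule S)
  \<comment> \<open>Writing f = (1 - T^2) S f gives T f = (1 - T^2)(T S f), and applying
    \<open>S\<close> removes the factor.\<close>
  have comm: "S (T f) = T (S f)" for f
  proof -
    have "S (T f) = S (T (S f - T (T (S f))))" by (simp add: S)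
    also have "\<dots> = S (T (S f) - T (T (T (S f))))" by (simp add: T.diff)
    finally show ?thesis by (simp add: S)
  qed
  define R where "R f = S (f + T f)" for f
  have "bounded_linear R"
    unfolding R_def
    by (intro bounded_linear_compose[OF S(1)] bounded_linear_add bounded_linear_ident T)
  moreover have "R (f - T f) = f" for f
    using S(2)[of f] by (simp add: R_def T.diff)
  moreover have "R f - T (R f) = f" for f
    using S(3)[of f] by (simp add: R_def T.add S.add comm)
  ultimately show ?thesis by blast
qed

section \<open>Linearity and boundedness of the operators\<close>

lemma bounded_linear_scaleC_bcontfun: "bounded_linear (scaleC_bcontfun z)"
proof (rule bounded_linear_intro[where K = "cmod z"])
  show "norm (scaleC_bcontfun z f) \<le> norm f * cmod z" for f :: "'a \<Rightarrow>\<^sub>C complex"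
    by (rule norm_bound) (simp add: norm_mult mult.commute mult_left_mono norm_bounded)
qed (auto intro!: bcontfun_eqI simp: algebra_simps)

lemma scaleC_bcontfun_scaleC_bcontfun [simp]:
  "scaleC_bcontfun z (scaleC_bcontfun w f) = scaleC_bcontfun (z * w) f"
  by (auto intro!: bcontfun_eqI)

lemma scaleC_bcontfun_one [simp]: "scaleC_bcontfun 1 f = f"
  by (auto intro!: bcontfun_eqI)

lemma sum_spin: "(\<Sum>i\<in>UNIV. g i) = g spin_down + g spin_up"
  by (simp add: UNIV_spin)

lemma norm_apply_ruelle_operator_le:
  assumes "continuous_on UNIV B"
  shows "cmod (apply_bcontfun (ruelle_operator B f) x)
    \<le> (\<Sum>i\<in>UNIV. exp (B (case_nat i x)) * cmod (apply_bcontfun f (case_nat i x)))"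
  unfolding apply_ruelle_operator[OF assms] by (rule order_trans[OF norm_sum]) simp

text \<open>Compactness bounds the potential by some \<open>c\<close>, and each of the two preimages
  then has weight at most \<open>exp c\<close>.\<close>

lemma bounded_linear_ruelle_operator:
  assumes B: "continuous_on UNIV B"
  shows "bounded_linear (ruelle_operator B)"
proof -
  obtain c where c: "\<And>x. \<bar>B x\<bar> \<le> c"
    using compact_imp_bounded[OF compact_continuous_image[OF B compact_UNIV_config]]
    by (auto simp: bounded_iff)
  show ?thesis
  proof (rule bounded_linear_intro[where K = "2 * exp c"])
    show "norm (ruelle_operator B f) \<le> norm f * (2 * exp c)" for f
    proof (rule norm_bound)
      fix x
      have "exp (B (case_nat i x)) * cmod (apply_bcontfun f (case_nat i x)) \<le> exp c * norm f" for i
        using c[of "case_nat i x"] by (intro mult_mono) (auto simp: norm_bounded)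
      then have "(\<Sum>i\<in>UNIV. exp (B (case_nat i x)) * cmod (apply_bcontfun f (case_nat i x)))
          \<le> exp c * norm f + exp c * norm f"
        unfolding sum_spin by (intro add_mono)
      then show "cmod (apply_bcontfun (ruelle_operator B f) x) \<le> norm f * (2 * exp c)"
        using norm_apply_ruelle_operator_le[OF B, of f x] by (simp add: algebra_simps)
    qed
  qed (auto intro!: bcontfun_eqI simp: apply_ruelle_operator[OF B] sum_spin algebra_simps)
qed

lemma ruelle_operator_scaleC_bcontfun:
  assumes "continuous_on UNIV B"
  shows "ruelle_operator B (scaleC_bcontfun z f) = scaleC_bcontfun z (ruelle_operator B f)"
  by (rule bcontfun_eqI) (simp add: apply_ruelle_operator[OF assms] sum_spin algebra_simps)

section \<open>Spectrum and spectral radius of a Ruelle operator\<close>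

text \<open>The hypothesis bounds L^2 1 by \<open>K\<close>. Since the weights are positive, this
  also bounds the norm of L^2, and every z with |z|^2 > K has a resolvent.\<close>

lemma spectrum_ruelle_operator_le:
  assumes B: "continuous_on UNIV B"
    and K: "\<And>x. (\<Sum>i\<in>UNIV. exp (B (case_nat i x)) *
      (\<Sum>j\<in>UNIV. exp (B (case_nat j (case_nat i x))))) \<le> K"
    and z: "z \<in> spectrum_op (ruelle_operator B)"
  shows "(cmod z)\<^sup>2 \<le> K"
proof (rule ccontr)
  assume "\<not> (cmod z)\<^sup>2 \<le> K"
  then have zK: "K < (cmod z)\<^sup>2" by simp
  have "0 \<le> K"
    by (rule order_trans[OF _ K[of undefined]]) (intro sum_nonneg mult_nonneg_nonneg; simp)
  then have z0: "z \<noteq> 0" using zK by auto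
  let ?L = "ruelle_operator B"
  have L2: "norm (?L (?L f)) \<le> K * norm f" for f
  proof (rule norm_bound)
    fix x
    have L1: "cmod (apply_bcontfun (?L f) y) \<le> (\<Sum>j\<in>UNIV. exp (B (case_nat j y))) * norm f" for y
      unfolding sum_distrib_right
      by (rule order_trans[OF norm_apply_ruelle_operator_le[OF B]])
        (intro sum_mono mult_left_mono norm_bounded; simp)
    have "cmod (apply_bcontfun (?L (?L f)) x)
        \<le> (\<Sum>i\<in>UNIV. exp (B (case_nat i x)) *
            ((\<Sum>j\<in>UNIV. exp (B (case_nat j (case_nat i x)))) * norm f))"
      by (rule order_trans[OF norm_apply_ruelle_operator_le[OF B]])
        (intro sum_mono mult_left_mono L1; simp)
    also have "\<dots> = (\<Sum>i\<in>UNIV. exp (B (case_nat i x)) *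
            (\<Sum>j\<in>UNIV. exp (B (case_nat j (case_nat i x))))) * norm f"
      by (simp add: sum_distrib_right mult.assoc)
    also have "\<dots> \<le> K * norm f"
      by (intro mult_right_mono K) simp
    finally show "cmod (apply_bcontfun (?L (?L f)) x) \<le> K * norm f" .
  qed
  \<comment> \<open>With this rescaling z - L = z (1 - T), and the square of \<open>T\<close>
    contracts by K / |z|^2 < 1.\<close>
  define T where "T f = scaleC_bcontfun (1 / z) (?L f)" for f
  have T: "bounded_linear T"
    unfolding T_def
    by (rule bounded_linear_compose[OF bounded_linear_scaleC_bcontfun
          bounded_linear_ruelle_operator[OF B]])
  have TT: "norm (T (T f)) \<le> K / (cmod z)\<^sup>2 * norm f" for f
  proof (rule norm_bound)
    fix x
    have "cmod (apply_bcontfun (T (T f)) x) = cmod (apply_bcontfun (?L (?L f)) x) / (cmod z)\<^sup>2"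
      by (simp add: T_def ruelle_operator_scaleC_bcontfun[OF B] norm_mult norm_divide
          power2_eq_square)
    also have "\<dots> \<le> K * norm f / (cmod z)\<^sup>2"
      by (intro divide_right_mono order_trans[OF norm_bounded L2]) simp
    finally show "cmod (apply_bcontfun (T (T f)) x) \<le> K / (cmod z)\<^sup>2 * norm f" by simp
  qed
  have q: "0 \<le> K / (cmod z)\<^sup>2" "K / (cmod z)\<^sup>2 < 1"
    using zK \<open>0 \<le> K\<close> z0 by auto
  obtain R where R: "bounded_linear R" "\<And>f. R (f - T f) = f" "\<And>f. R f - T (R f) = f"
    using Neumann_inverse_square[OF complete_UNIV_bcontfun T q TT] by blast
  have eq: "scaleC_bcontfun z f - ?L f = scaleC_bcontfun z (f - T f)" for f
    by (rule bcontfun_eqI) (use z0 in \<open>simp add: T_def right_diff_distrib\<close>)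
  have "bounded_linear (\<lambda>f. R (scaleC_bcontfun (1 / z) f))"
    by (rule bounded_linear_compose[OF R(1) bounded_linear_scaleC_bcontfun])
  moreover have "R (scaleC_bcontfun (1 / z) (scaleC_bcontfun z f - ?L f)) = f" for f
    using z0 by (simp add: eq R)
  moreover have "scaleC_bcontfun z (R (scaleC_bcontfun (1 / z) f))
      - ?L (R (scaleC_bcontfun (1 / z) f)) = f" for f
    using z0 by (simp add: eq R)
  ultimately have "z \<notin> spectrum_op ?L"
    unfolding spectrum_op_def by blast
  then show False using z by simp
qed

text \<open>The function x_1 exp(-B(x)) lies in the kernel: its exponential cancels the weights, and
  the two preimages contribute +1 and -1.\<close>

lemma zero_in_spectrum_ruelle_operator:
  assumes B: "continuous_on UNIV B"
  shows "0 \<in> spectrum_op (ruelle_operator B)"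
proof (rule ccontr)
  assume "0 \<notin> spectrum_op (ruelle_operator B)"
  then obtain R where R: "bounded_linear R"
    "\<And>f. R (scaleC_bcontfun 0 f - ruelle_operator B f) = f"
    unfolding spectrum_op_def by blast
  have spin: "continuous_on UNIV (\<lambda>x :: config. spin_val (x 0))"
    by (rule continuous_on_compose2[of UNIV spin_val])
      (auto simp: continuous_on_open_vimage open_discrete)
  define g where "g x = complex_of_real (spin_val (x 0) * exp (- B x))" for x
  define f where "f = Bcontfun g"
  have "continuous_on UNIV g"
    unfolding g_def by (intro continuous_intros spin B)
  then have f: "apply_bcontfun f = g"
    by (simp add: f_def Bcontfun_inverse continuous_in_bcontfun)
  have val: "spin_val spin_up = 1" "spin_val spin_down = -1"
    by (transfer, simp)+
  have "scaleC_bcontfun 0 f - ruelle_operator B f = 0"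
    by (rule bcontfun_eqI)
      (simp add: apply_ruelle_operator[OF B] f g_def sum_spin val scaleR_conv_of_real
        exp_minus flip: of_real_mult)
  then have "f = 0"
    using R(2)[of f] linear_0[OF bounded_linear.linear[OF R(1)]] by simp
  then have "g (\<lambda>_. spin_up) = 0" using f by (metis zero_bcontfun.rep_eq)
  then show False by (simp add: g_def val)
qed

text \<open>The spectral value 0 serves twice: it makes the supremum range over a nonempty set, and
  it gives the lower bound.\<close>

lemma spectral_radius_ruelle_operator_le:
  assumes B: "continuous_on UNIV B"
    and K: "\<And>x. (\<Sum>i\<in>UNIV. exp (B (case_nat i x)) *
      (\<Sum>j\<in>UNIV. exp (B (case_nat j (case_nat i x))))) \<le> K"
  shows "0 \<le> spectral_radius_op (ruelle_operator B)"
    and "spectral_radius_op (ruelle_operator B) \<le> sqrt K"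
proof -
  have le: "cmod z \<le> sqrt K" if "z \<in> spectrum_op (ruelle_operator B)" for z
    using spectrum_ruelle_operator_le[OF B K that] by (simp add: real_le_rsqrt)
  show "spectral_radius_op (ruelle_operator B) \<le> sqrt K"
    unfolding spectral_radius_op_def
    by (rule cSUP_least) (use zero_in_spectrum_ruelle_operator[OF B] le in auto)
  have "bdd_above (cmod ` spectrum_op (ruelle_operator B))"
    using le by (auto intro!: bdd_aboveI2)
  then show "0 \<le> spectral_radius_op (ruelle_operator B)"
    unfolding spectral_radius_op_def
    using cSUP_upper[OF zero_in_spectrum_ruelle_operator[OF B], of cmod] by simp
qed

section \<open>The field acting on a prepended spin\<close>

text \<open>This is the function S of the outline: once a spin is prepended to \<open>x\<close>, the
  site \<open>x k\<close> lies at distance \<open>Suc k\<close> from it.\<close>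

definition dyson_field :: "real \<Rightarrow> config \<Rightarrow> real"
  where "dyson_field \<gamma> x = (\<Sum>k. real (Suc k) powr (- \<gamma>) * spin_val (x k))"

lemma summable_dyson_field:
  assumes "\<gamma> > 1"
  shows "summable (\<lambda>k. real (Suc k) powr (- \<gamma>) * spin_val (x k))"
  by (rule summable_comparison_test'[OF summable_powr_Suc[OF assms], of 0]) (simp add: abs_mult)

lemma dyson_potential_case_nat:
  assumes "\<gamma> > 1"
  shows "dyson_potential \<gamma> (case_nat i x) = spin_val i * dyson_field \<gamma> x"
  unfolding dyson_potential_def dyson_field_def
  by (subst suminf_mult[OF summable_dyson_field[OF assms], symmetric]) (simp add: algebra_simps)

lemma zeta_real_powr: "zeta_real \<gamma> = (\<Sum>k. real (Suc k) powr (- \<gamma>))"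
  unfolding zeta_real_def by (simp add: powr_minus inverse_eq_divide)

lemma abs_dyson_field_le:
  assumes "\<gamma> > 1"
  shows "\<bar>dyson_field \<gamma> x\<bar> \<le> zeta_real \<gamma>"
proof -
  have "norm (dyson_field \<gamma> x) \<le> (\<Sum>k. real (Suc k) powr (- \<gamma>))"
    unfolding dyson_field_def
    by (rule norm_suminf_le[OF _ summable_powr_Suc[OF assms]]) (simp add: abs_mult)
  then show ?thesis by (simp add: zeta_real_powr)
qed

text \<open>The first two terms have opposite signs, so together they have modulus 1 - 2^(-\<gamma>)
  instead of 1 + 2^(-\<gamma>); the tail is estimated as before.\<close>

lemma abs_dyson_field_le_if_neq:
  assumes "\<gamma> > 1" and neq: "spin_val (y 1) = - spin_val (y 0)"
  shows "\<bar>dyson_field \<gamma> y\<bar> \<le> zeta_real \<gamma> - 2 * 2 powr (- \<gamma>)"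
proof -
  let ?a = "\<lambda>k. real (Suc k) powr (- \<gamma>)"
  let ?tail = "\<Sum>k. ?a (k + 2) * spin_val (y (k + 2))"
  have sa: "summable (\<lambda>k. ?a (k + 2))"
    by (rule summable_ignore_initial_segment[OF summable_powr_Suc[OF assms(1)]])
  have D: "dyson_field \<gamma> y = ?tail + spin_val (y 0) * (1 - 2 powr (- \<gamma>))"
    unfolding dyson_field_def
    by (subst suminf_split_initial_segment[OF summable_dyson_field[OF assms(1)], of _ 2])
      (use neq in \<open>simp add: numeral_2_eq_2 algebra_simps\<close>)
  have Z: "zeta_real \<gamma> = (\<Sum>k. ?a (k + 2)) + (1 + 2 powr (- \<gamma>))"
    unfolding zeta_real_powr
    by (subst suminf_split_initial_segment[OF summable_powr_Suc[OF assms(1)], of 2])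
      (simp add: numeral_2_eq_2)
  have "norm ?tail \<le> (\<Sum>k. ?a (k + 2))"
    by (rule norm_suminf_le[OF _ sa]) (simp add: abs_mult)
  moreover have "\<bar>spin_val (y 0) * (1 - 2 powr (- \<gamma>))\<bar> \<le> 1 - 2 powr (- \<gamma>)"
    using assms(1) powr_mono[of "-\<gamma>" 0 "2::real"] by (simp add: abs_mult)
  ultimately show ?thesis unfolding D Z by simp
qed

section \<open>Two-step estimate for the Dyson potential\<close>

lemma cosh_mono_abs:
  fixes x y :: real
  assumes "\<bar>x\<bar> \<le> y"
  shows "cosh x \<le> cosh y"
proof -
  have "cosh \<bar>x\<bar> \<le> cosh y" using assms by (subst cosh_real_nonneg_le_iff) auto
  then show ?thesis by simp
qed

text \<open>The outer weights sum to at most \<open>M\<close>, and so does each inner pair. For the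
  prepended spin opposite to \<open>x 0\<close> the inner sum is even at most \<open>m\<close>, and
  its outer weight is at least \<open>exp (- \<beta> * zeta_real \<gamma>)\<close>; hence a gain
  over M^2 that is uniform in \<open>x\<close>.\<close>

lemma dyson_two_step_bound:
  assumes \<gamma>: "\<gamma> > 1" and \<beta>: "\<beta> > 0"
  defines "B \<equiv> \<lambda>x. \<beta> * dyson_potential \<gamma> x"
    and "M \<equiv> 2 * cosh (\<beta> * zeta_real \<gamma>)"
    and "m \<equiv> 2 * cosh (\<beta> * (zeta_real \<gamma> - 2 * 2 powr (- \<gamma>)))"
  shows "(\<Sum>i\<in>UNIV. exp (B (case_nat i x)) * (\<Sum>j\<in>UNIV. exp (B (case_nat j (case_nat i x)))))
    \<le> M\<^sup>2 - exp (- \<beta> * zeta_real \<gamma>) * (M - m)"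
    and "m < M"
proof -
  have val: "spin_val spin_up = 1" "spin_val spin_down = -1"
    by (transfer, simp)+
  have one: "(\<Sum>j\<in>UNIV. exp (B (case_nat j y))) = 2 * cosh (\<beta> * dyson_field \<gamma> y)" for y
    by (simp add: sum_spin B_def dyson_potential_case_nat[OF \<gamma>] val cosh_field_def)
  have le_M: "2 * cosh (\<beta> * dyson_field \<gamma> y) \<le> M" for y
    unfolding M_def using abs_dyson_field_le[OF \<gamma>, of y] \<beta>
    by (intro mult_left_mono cosh_mono_abs) (auto simp: abs_mult)
  have le_m: "2 * cosh (\<beta> * dyson_field \<gamma> y) \<le> m" if "spin_val (y 1) = - spin_val (y 0)" for y
    unfolding m_def using abs_dyson_field_le_if_neq[OF \<gamma> that] \<beta>
    by (intro mult_left_mono cosh_mono_abs) (auto simp: abs_mult)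
  \<comment> \<open>Any configuration with opposite first two spins shows this, as the bounded
    modulus is nonnegative. It puts both arguments of \<open>cosh\<close> where it is
    increasing.\<close>
  have nonneg: "0 \<le> zeta_real \<gamma> - 2 * 2 powr (- \<gamma>)"
    using abs_dyson_field_le_if_neq[OF \<gamma>, of "case_nat spin_up (\<lambda>_. spin_down)"]
    by (simp add: val)
  then have "\<beta> * (zeta_real \<gamma> - 2 * 2 powr (- \<gamma>)) < \<beta> * zeta_real \<gamma>"
    "0 \<le> \<beta> * (zeta_real \<gamma> - 2 * 2 powr (- \<gamma>))"
    using \<beta> by auto
  then show "m < M"
    unfolding m_def M_def by (simp add: cosh_real_nonneg_less_iff)
  \<comment> \<open>Here \<open>u\<close> and \<open>s\<close> are the outer weight and inner sum
    for the spin equal to \<open>x 0\<close>, while \<open>v\<close> and \<open>t\<close> belong to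
    the opposite spin.\<close>
  have two: "u * s + v * t \<le> M\<^sup>2 - exp (- \<beta> * zeta_real \<gamma>) * (M - m)"
    if "u + v \<le> M" "exp (- \<beta> * zeta_real \<gamma>) \<le> v" "0 \<le> u" "s \<le> M" "t \<le> m" for u v s t
  proof -
    have "0 \<le> v" using that(2) exp_ge_zero order_trans by blast
    have "0 \<le> M" by (simp add: M_def)
    have "u * s + v * t \<le> u * M + v * m"
      using that \<open>0 \<le> v\<close> by (intro add_mono mult_left_mono)
    also have "\<dots> = (u + v) * M - v * (M - m)" by (simp add: algebra_simps)
    also have "\<dots> \<le> M * M - exp (- \<beta> * zeta_real \<gamma>) * (M - m)"
      using that \<open>m < M\<close> \<open>0 \<le> M\<close> by (intro diff_mono mult_right_mono) auto
    finally show ?thesis by (simp add: power2_eq_square)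
  qed
  have low: "exp (- \<beta> * zeta_real \<gamma>) \<le> exp (B (case_nat i x))" for i
  proof -
    have "\<bar>B (case_nat i x)\<bar> \<le> \<beta> * zeta_real \<gamma>"
      using abs_dyson_field_le[OF \<gamma>, of x] \<beta>
      by (simp add: B_def dyson_potential_case_nat[OF \<gamma>] abs_mult)
    then show ?thesis by simp
  qed
  have sum_M: "exp (B (case_nat spin_down x)) + exp (B (case_nat spin_up x)) \<le> M"
    using le_M[of x] one[of x] by (simp add: sum_spin)
  show "(\<Sum>i\<in>UNIV. exp (B (case_nat i x)) * (\<Sum>j\<in>UNIV. exp (B (case_nat j (case_nat i x)))))
    \<le> M\<^sup>2 - exp (- \<beta> * zeta_real \<gamma>) * (M - m)"
  proof (cases "x 0 = spin_up")
    case True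
    \<comment> \<open>\<open>sum_spin\<close> lists \<open>spin_down\<close> first, which is the
      opposite spin in this case; the summands are swapped to fit \<open>two\<close>.\<close>
    then show ?thesis
      unfolding one sum_spin
      by (subst add.commute, intro two low le_M le_m) (use sum_M in \<open>auto simp: val add.commute\<close>)
  next
    case False
    then have "x 0 = spin_down" using UNIV_spin by auto
    then show ?thesis
      unfolding one sum_spin
      by (intro two low le_M le_m) (use sum_M in \<open>auto simp: val\<close>)
  qed
qed

section \<open>Strict bound for the pressure\<close>

theorem mainTheorem2:
  fixes \<gamma> \<beta> :: real
  assumes "\<gamma> > 2" and "\<beta> > 0"
  shows "pressure (\<lambda>x. \<beta> * dyson_potential \<gamma> x)
      = ln (spectral_radius_op (ruelle_operator (\<lambda>x. \<beta> * dyson_potential \<gamma> x)))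
    \<and> ln (spectral_radius_op (ruelle_operator (\<lambda>x. \<beta> * dyson_potential \<gamma> x)))
      < ln (2 * cosh (\<beta> * zeta_real \<gamma>))"
proof
  let ?B = "\<lambda>x. \<beta> * dyson_potential \<gamma> x"
  let ?r = "spectral_radius_op (ruelle_operator ?B)"
  let ?M = "2 * cosh (\<beta> * zeta_real \<gamma>)"
  let ?m = "2 * cosh (\<beta> * (zeta_real \<gamma> - 2 * 2 powr (- \<gamma>)))"
  let ?K = "?M\<^sup>2 - exp (- \<beta> * zeta_real \<gamma>) * (?M - ?m)"
  show "pressure ?B = ln ?r" by (rule pressure_def)
  have \<gamma>: "\<gamma> > 1" using assms by simp
  have B: "continuous_on UNIV ?B"
    by (intro continuous_intros continuous_on_dyson_potential \<gamma>)
  note r = spectral_radius_ruelle_operator_le[OF B dyson_two_step_bound(1)[OF \<gamma> assms(2)]]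
  \<comment> \<open>Strictness enters through \<open>?m < ?M\<close>; the square root below undoes
    the passage to two steps.\<close>
  have "?K < ?M\<^sup>2" using dyson_two_step_bound(2)[OF \<gamma> assms(2)] by simp
  then have "sqrt ?K < ?M" by (intro real_less_lsqrt) auto
  then have "?r < ?M" using r(2) by linarith
  moreover have "1 < ?M" using cosh_real_ge_1[of "\<beta> * zeta_real \<gamma>"] by linarith
  ultimately show "ln ?r < ln ?M"
    \<comment> \<open>the junk value \<open>ln 0 = 0\<close> is harmless since \<open>?M > 1\<close>\<close>
    using r(1) by (cases "?r = 0") (auto simp: ln_gt_zero)
qed

end
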